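(* The family of finite groups $G$ such that every nontrivial Sylow subgroup of the center $Z(G)$ is noncyclic is maximal cyclic bounded; that is, for every natural number $n$ there are, up to isomorphism, only finitely many finite groups $G$ such that every nontrivial Sylow subgroup of $Z(G)$ is noncyclic and $\lambda(G)\leqslant n$.
   Context: A subgroup $H$ of a finite group $G$ is called a maximal cyclic subgroup if it is cyclic and not properly contained in any cyclic subgroup of $G$. $\lambda(G)$ denotes the number of maximal cyclic subgroups of $G$. A family $\mathscr{F}$ of finite groups is called maximal cyclic bounded (MCB) if, for every natural number $n$, there are only finitely many groups $G$ in $\mathscr{F}$ up to isomorphism with $\lambda(G)\leqslant n$. Groups with trivial center satisfy the condition on Sylow subgroups of $Z(G)$ vacuously. *)

theory Defs
  imports "HOL-Algebra.Algebra"
begin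

definition is_maximal_cyclic_subgroup :: "'a set \<Rightarrow> ('a, 'b) monoid_scheme \<Rightarrow> bool" where
  "is_maximal_cyclic_subgroup H G \<longleftrightarrow>
     subgroup H G \<and> cyclic_group (G\<lparr>carrier := H\<rparr>) \<and>
     (\<forall>K. subgroup K G \<and> cyclic_group (G\<lparr>carrier := K\<rparr>) \<longrightarrow> \<not> H \<subset> K)"

definition num_maximal_cyclic_subgroups :: "('a, 'b) monoid_scheme \<Rightarrow> nat" where
  "num_maximal_cyclic_subgroups G = card {H. is_maximal_cyclic_subgroup H G}"

definition group_center :: "('a, 'b) monoid_scheme \<Rightarrow> 'a set" where
  "group_center G =
     {z \<in> carrier G. \<forall>x \<in> carrier G. z \<otimes>\<^bsub>G\<^esub> x = x \<otimes>\<^bsub>G\<^esub> z}"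

text \<open>
  Meant for finite groups. If \<open>p\<close> does not divide the order, the only
  Sylow \<open>p\<close>-subgroup is the trivial one.
\<close>

definition is_Sylow_subgroup :: "nat \<Rightarrow> 'a set \<Rightarrow> ('a, 'b) monoid_scheme \<Rightarrow> bool" where
  "is_Sylow_subgroup p P G \<longleftrightarrow>
     Factorial_Ring.prime p \<and> subgroup P G \<and> card P = p ^ multiplicity p (order G)"

definition finite_up_to_iso :: "('a, 'b) monoid_scheme set \<Rightarrow> bool" where
  "finite_up_to_iso A \<longleftrightarrow> finite (A // {(G, H). G \<in> A \<and> H \<in> A \<and> G \<cong> H})"

text \<open>
  A family of finite groups is a set of groups whose carriers lie in a common type
  \<open>'a\<close>. Statements about all finite groups are made with \<open>'a\<close> arbitrary; the
  instance \<open>'a = nat\<close> already contains a copy of every finite group.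
\<close>

definition maximal_cyclic_bounded :: "('a, 'b) monoid_scheme set \<Rightarrow> bool" where
  "maximal_cyclic_bounded F \<longleftrightarrow>
     (\<forall>G \<in> F. group G \<and> finite (carrier G)) \<and>
     (\<forall>n. finite_up_to_iso {G \<in> F. num_maximal_cyclic_subgroups G \<le> n})"

end

theory Submission
  imports Defs "HOL-Number_Theory.Cong"
begin

text \<open>
  The maximal cyclic subgroups \<open>M\<^sub>1, \<dots>, M\<^sub>k\<close> of a finite group \<open>G\<close> form an irredundant cover, and their
  intersection \<open>D\<close> is central. If an element \<open>d\<close> of \<open>D\<close> had prime order \<open>p\<close>, every
  element of order \<open>p\<close> of the Sylow \<open>p\<close>-subgroup \<open>P\<close> of \<open>Z(G)\<close> would share some \<open>M\<^sub>i\<close> with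
  \<open>d\<close>, hence would lie in the only subgroup of order \<open>p\<close> of that \<open>M\<^sub>i\<close>, which is
  \<open>\<langle>d\<rangle>\<close>. An abelian \<open>p\<close>-group with at most one subgroup of order \<open>p\<close> is cyclic, so \<open>P\<close> would
  be cyclic and nontrivial. Hence \<open>D = 1\<close>. On the other hand B. H. Neumann's argument on
  irredundant covers bounds the index of \<open>D\<close> by \<open>k\<^sup>k\<close>.
\<close>

section \<open>Cyclic subgroups of a finite group\<close>

lemma (in group) nat_pow_mod_eq:
  assumes "b \<in> carrier G" "b [^] p = \<one>"
  shows "b [^] (n mod p) = b [^] (n::nat)"
proof -
  have "b [^] n = b [^] (p * (n div p) + n mod p)" by simp
  also have "\<dots> = b [^] (p * (n div p)) \<otimes> b [^] (n mod p)"
    using assms(1) by (simp only: nat_pow_mult)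
  also have "b [^] (p * (n div p)) = \<one>"
    using assms by (simp flip: nat_pow_pow)
  finally show ?thesis using assms(1) by simp
qed

text \<open>The definition of \<open>cyclic_group\<close> goes through
  \<open>subgroup_generated\<close> inside the structure itself; with \<open>generate G\<close> all
  cyclic subgroups are described in one ambient group.\<close>

lemma (in group) cyclic_subgroup_iff:
  assumes "subgroup H G"
  shows "cyclic_group (G\<lparr>carrier := H\<rparr>) \<longleftrightarrow> (\<exists>x\<in>H. H = generate G {x})"
proof -
  have "subgroup_generated (G\<lparr>carrier := H\<rparr>) {x} = G\<lparr>carrier := H\<rparr> \<longleftrightarrow> H = generate G {x}"
    if "x \<in> H" for x
  proof -
    have "subgroup_generated (G\<lparr>carrier := H\<rparr>) {x} = G\<lparr>carrier := generate G {x}\<rparr>"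
      using that assms generate_consistent[of "{x}" H]
      by (simp add: subgroup_generated_def)
    then show ?thesis
      by (metis partial_object.select_convs(1) partial_object.surjective partial_object.update_convs(1))
  qed
  then show ?thesis
    unfolding cyclic_group_def by auto
qed

lemma (in group) cyclic_subgroup_generate:
  assumes "x \<in> carrier G"
  shows "cyclic_group (G\<lparr>carrier := generate G {x}\<rparr>)"
  using assms cyclic_subgroup_iff[OF generate_is_subgroup, of "{x}"] generate.incl[of x "{x}" G]
  by auto

lemma (in group) maximal_cyclic_subgroupE:
  assumes "is_maximal_cyclic_subgroup H G"
  obtains x where "x \<in> carrier G" "H = generate G {x}"
  using assms cyclic_subgroup_iff subgroup.mem_carrier
  unfolding is_maximal_cyclic_subgroup_def by metis

text \<open>A maximal member of the finite set of cyclic subgroups through \<open>x\<close> is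
  maximal among all cyclic subgroups, because anything above it still contains
  \<open>x\<close>.\<close>

lemma (in group) ex_maximal_cyclic_subgroup:
  assumes "finite (carrier G)" "x \<in> carrier G"
  shows "\<exists>M. is_maximal_cyclic_subgroup M G \<and> x \<in> M"
proof -
  let ?C = "{K. subgroup K G \<and> cyclic_group (G\<lparr>carrier := K\<rparr>) \<and> x \<in> K}"
  have "finite ?C"
    using assms(1) by (auto intro: finite_subset[of _ "Pow (carrier G)"] dest: subgroup.subset)
  moreover have "generate G {x} \<in> ?C"
    using assms(2) by (simp add: cyclic_subgroup_generate generate_is_subgroup generate.incl)
  ultimately obtain M where "M \<in> ?C" and "\<And>K. K \<in> ?C \<Longrightarrow> M \<subseteq> K \<Longrightarrow> M = K"
    using finite_has_maximal[of ?C] by blast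
  then show ?thesis
    unfolding is_maximal_cyclic_subgroup_def by blast
qed

lemma (in group) mem_generate_nat_pow:
  assumes "finite (carrier G)" "a \<in> carrier G" "x \<in> generate G {a}"
  obtains k :: nat where "x = a [^] k"
  using assms generate_pow_on_finite_carrier by auto

text \<open>With \<open>ord a = p * q\<close>, the elements of \<open>generate G {a}\<close> killed
  by \<open>p\<close> are powers of \<open>a [^] q\<close>, and since \<open>p\<close> is prime any
  nontrivial one generates the rest. Thus a cyclic group has at most one subgroup of order
  \<open>p\<close>.\<close>

lemma (in group) prime_order_mem_generate:
  fixes p :: nat
  assumes fin: "finite (carrier G)" and a: "a \<in> carrier G"
    and x: "x \<in> generate G {a}" and y: "y \<in> generate G {a}"
    and p: "Factorial_Ring.prime p" and ordx: "ord x = p" and yp: "y [^] p = \<one>"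
  shows "y \<in> generate G {x}"
proof -
  obtain i :: nat where i: "x = a [^] i" using mem_generate_nat_pow fin a x by blast
  obtain j :: nat where j: "y = a [^] j" using mem_generate_nat_pow fin a y by blast
  have xc: "x \<in> carrier G" using a i by simp
  have "x [^] ord a = \<one>"
    using a by (simp add: i nat_pow_pow) (metis mult.commute nat_pow_one nat_pow_pow pow_ord_eq_1)
  then have "p dvd ord a" using xc ordx pow_eq_id by blast
  then obtain q where q: "ord a = p * q" by blast
  define b where "b = a [^] q"
  have b: "b \<in> carrier G" "b [^] p = \<one>"
    using a by (simp_all add: b_def nat_pow_pow mult.commute flip: q)
  have ex: "\<exists>s. a [^] k = b [^] (s::nat)" if "(a [^] k) [^] p = \<one>" for k :: nat
  proof -
    have "p * q dvd p * k"
      using that a by (simp add: nat_pow_pow pow_eq_id q mult.commute)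
    then have "q dvd k" using p prime_gt_0_nat by auto
    then show ?thesis using a by (auto simp: b_def nat_pow_pow)
  qed
  have "x [^] p = \<one>" using xc ordx by (metis pow_ord_eq_1)
  then obtain s where s: "x = b [^] (s::nat)" using ex i by blast
  obtain t where t: "y = b [^] (t::nat)" using ex j yp by blast
  have "\<not> p dvd s"
  proof
    assume "p dvd s"
    then have "x = \<one>" using b s by (auto simp flip: nat_pow_pow)
    then show False using ordx p by auto
  qed
  then have "coprime s p"
    using p prime_imp_coprime coprime_commute by blast
  \<comment> \<open>As \<open>u\<close> inverts \<open>s\<close> modulo \<open>p\<close>,
    \<open>x [^] u\<close> recovers \<open>b\<close>, and hence \<open>x [^] (u * t)\<close> is
    \<open>y\<close>.\<close>
  then obtain u where u: "[s * u = 1] (mod p)" using cong_solve_coprime_nat by auto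
  have "x [^] (u * t) = b [^] ((s * u) * t)" using b s by (simp add: nat_pow_pow mult.assoc)
  also have "\<dots> = b [^] (((s * u) * t) mod p)" using b by (simp add: nat_pow_mod_eq)
  also have "((s * u) * t) mod p = t mod p"
    using cong_scalar_right[OF u, of t] by (simp add: cong_def)
  also have "b [^] (t mod p) = y" using b t by (simp add: nat_pow_mod_eq)
  finally show ?thesis
    using generate_pow_on_finite_carrier[OF fin xc] by blast
qed

section \<open>A cyclicity criterion for abelian groups of prime power order\<close>

lemma (in comm_group) card_prime_power_torsion_le:
  fixes p :: nat
  assumes fin: "finite (carrier G)" and le: "card {x \<in> carrier G. x [^] p = \<one>} \<le> p"
  shows "card {x \<in> carrier G. x [^] (p ^ k) = \<one>} \<le> p ^ k"
  \<comment> \<open>The \<open>p\<close>-th power map sends \<open>p\<^sup>k\<^sup>+\<^sup>1\<close>-torsion to \<open>p\<^sup>k\<close>-torsion, with fibres of size at most \<open>p\<close>.\<close>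
proof (induction k)
  case 0
  have "{x \<in> carrier G. x [^] (p ^ 0) = \<one>} = {\<one>}" by auto
  then show ?case by simp
next
  case (Suc k)
  let ?S = "\<lambda>k. {x \<in> carrier G. x [^] (p ^ k) = \<one>}"
  let ?F = "\<lambda>z. {x \<in> ?S (Suc k). x [^] p = z}"
  have finS: "finite (?S j)" for j using fin by simp
  have "?S (Suc k) \<subseteq> (\<Union>z\<in>?S k. ?F z)"
    by (auto simp: nat_pow_pow)
  then have "card (?S (Suc k)) \<le> card (\<Union>z\<in>?S k. ?F z)"
    using fin by (intro card_mono) auto
  also have "\<dots> \<le> (\<Sum>z\<in>?S k. card (?F z))"
    using finS by (rule card_UN_le)
  also have "\<dots> \<le> (\<Sum>z\<in>?S k. p)"
  proof (rule sum_mono)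
    fix z assume "z \<in> ?S k"
    show "card (?F z) \<le> p"
    proof (cases "?F z = {}")
      case True
      then show ?thesis by (metis card.empty zero_le)
    next
      case False
      then obtain w where w: "w \<in> carrier G" "w [^] p = z" by auto
      \<comment> \<open>Division by one point \<open>w\<close> of the fibre lands in the
        \<open>p\<close>-torsion, because the \<open>p\<close>-th power is multiplicative in a
        commutative group.\<close>
      have "card (?F z) \<le> card {x \<in> carrier G. x [^] p = \<one>}"
      proof (rule card_inj_on_le)
        show "inj_on (\<lambda>x. x \<otimes> inv w) (?F z)"
          using w by (auto simp: inj_on_def)
        show "(\<lambda>x. x \<otimes> inv w) ` ?F z \<subseteq> {x \<in> carrier G. x [^] p = \<one>}"
          using w by (auto simp: pow_mult_distrib m_comm nat_pow_inv)
      qed (use fin in simp)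
      then show ?thesis using le by linarith
    qed
  qed
  also have "\<dots> \<le> p ^ Suc k" using Suc.IH by (simp add: mult.commute)
  finally show ?case .
qed

text \<open>If \<open>m = Suc k\<close> and \<open>p ^ k\<close> killed every element, the torsion
  count would give \<open>p ^ m \<le> p ^ k\<close>. So some element has the full order
  \<open>p ^ m\<close> and generates the group.\<close>

lemma (in comm_group) cyclic_group_of_prime_torsion_le:
  fixes p :: nat
  assumes p: "Factorial_Ring.prime p" and card: "order G = p ^ m"
    and le: "card {x \<in> carrier G. x [^] p = \<one>} \<le> p"
  shows "cyclic_group G"
proof -
  have fin: "finite (carrier G)"
    using p card prime_gt_0_nat order_gt_0_iff_finite by simp
  have "\<exists>x\<in>carrier G. ord x = p ^ m"
  proof (cases m)
    case 0
    then show ?thesis by (intro bexI[of _ \<one>]) auto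
  next
    case (Suc k)
    have "\<exists>x\<in>carrier G. x [^] (p ^ k) \<noteq> \<one>"
    proof (rule ccontr)
      assume "\<not> ?thesis"
      then have "{x \<in> carrier G. x [^] (p ^ k) = \<one>} = carrier G" by auto
      then have "p ^ m \<le> p ^ k"
        using card_prime_power_torsion_le[OF fin le, of k] card by (simp add: order_def)
      then show False using Suc prime_gt_1_nat[OF p] by simp
    qed
    then obtain x where x: "x \<in> carrier G" "x [^] (p ^ k) \<noteq> \<one>" by blast
    have "ord x dvd p ^ m" using x(1) card ord_dvd_group_order by metis
    then obtain j where j: "j \<le> m" "ord x = p ^ j"
      using p divides_primepow_nat by blast
    have "\<not> j \<le> k"
      using x j(2) pow_eq_id le_imp_power_dvd by metis
    then show ?thesis using x(1) j Suc by (intro bexI[of _ x]) (auto simp: le_Suc_eq)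
  qed
  then obtain x where x: "x \<in> carrier G" "ord x = p ^ m" by blast
  have "generate G {x} = carrier G"
    using x card fin generate_pow_card[of x] generate_incl[of "{x}"]
    by (intro card_subset_eq) (auto simp: order_def)
  then show ?thesis
    using x(1) cyclic_subgroup_iff[OF subgroup_self] by auto
qed


section \<open>Neumann's bound for irredundant covers by subgroups\<close>

text \<open>The members of \<open>F\<close> are intersected one at a time. The next member can
  always be chosen so that the intersection shrinks by a factor of at most \<open>card F\<close>,
  and after \<open>card F\<close> steps all of \<open>F\<close> is used.\<close>

lemma (in group) order_le_irredundant_cover:
  assumes fin: "finite (carrier G)" and finF: "finite F"
    and sub: "\<And>H. H \<in> F \<Longrightarrow> subgroup H G"
    and cover: "carrier G \<subseteq> \<Union>F"
    and irred: "\<And>H. H \<in> F \<Longrightarrow> \<not> carrier G \<subseteq> \<Union>(F - {H})"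
  shows "order G \<le> card F ^ card F * card (\<Inter>F)"
proof -
  \<comment> \<open>The factor \<open>carrier G\<close> makes \<open>?D {}\<close> the whole group,
    where the induction starts; \<open>\<Inter>{}\<close> alone would be
    \<open>UNIV\<close>.\<close>
  let ?D = "\<lambda>S. carrier G \<inter> \<Inter>S"
  have step: "\<exists>S. S \<subseteq> F \<and> card S = k \<and> order G \<le> card F ^ k * card (?D S)"
    if "k \<le> card F" for k
    using that
  proof (induction k)
    case 0
    show ?case by (intro exI[of _ "{}"]) (simp add: order_def)
  next
    case (Suc k)
    then obtain S where S: "S \<subseteq> F" "card S = k" "order G \<le> card F ^ k * card (?D S)"
      by auto
    have finS: "finite S" using S(1) finF finite_subset by blast
    have "S \<noteq> F" using S(2) Suc.prems by auto
    then obtain H0 where "H0 \<in> F" "H0 \<notin> S" using S(1) by blast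
    \<comment> \<open>A point that \<open>F - {H0}\<close> fails to cover avoids every member of
      \<open>S\<close>, since \<open>S\<close> is contained in \<open>F - {H0}\<close>.\<close>
    then obtain g where g: "g \<in> carrier G" "g \<notin> \<Union>S"
      using irred[of H0] S(1) by blast
    \<comment> \<open>The coset \<open>g ?D S\<close> misses the members of \<open>S\<close>, so it is covered by the others; one of them
      meets it in at least a \<open>1 / card F\<close> fraction.\<close>
    have notin: "g \<otimes> d \<notin> H" if "H \<in> S" "d \<in> ?D S" for H d
    proof
      assume "g \<otimes> d \<in> H"
      interpret H: subgroup H G using sub S(1) that(1) by blast
      have "d \<in> H" using that by blast
      then have "(g \<otimes> d) \<otimes> inv d \<in> H" using \<open>g \<otimes> d \<in> H\<close> by simp
      then show False using g that H.mem_carrier[OF \<open>d \<in> H\<close>] by (auto simp: m_assoc)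
    qed
    let ?E = "\<lambda>H. {d \<in> ?D S. g \<otimes> d \<in> H}"
    have "?D S \<subseteq> (\<Union>H\<in>F - S. ?E H)"
    proof
      fix d assume d: "d \<in> ?D S"
      then have "g \<otimes> d \<in> \<Union>F" using cover g(1) by blast
      then show "d \<in> (\<Union>H\<in>F - S. ?E H)" using d notin by blast
    qed
    then have "card (?D S) \<le> card (\<Union>H\<in>F - S. ?E H)"
      using fin finF by (intro card_mono) auto
    also have "\<dots> \<le> (\<Sum>H\<in>F - S. card (?E H))"
      using finF by (intro card_UN_le) simp
    also have "\<dots> \<le> (\<Sum>H\<in>F - S. card (?D (insert H S)))"
    proof (rule sum_mono)
      fix H assume H: "H \<in> F - S"
      interpret H: subgroup H G using sub H by blast
      show "card (?E H) \<le> card (?D (insert H S))"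
      proof (cases "?E H = {}")
        case True
        then show ?thesis by (metis card.empty zero_le)
      next
        case False
        then obtain e where e: "e \<in> ?D S" "g \<otimes> e \<in> H" by blast
        show ?thesis
        proof (rule card_inj_on_le)
          show "inj_on (\<lambda>d. inv e \<otimes> d) (?E H)"
            using e by (auto simp: inj_on_def)
          show "(\<lambda>d. inv e \<otimes> d) ` ?E H \<subseteq> ?D (insert H S)"
          proof clarify
            fix d assume d: "d \<in> carrier G" "d \<in> \<Inter>S" "g \<otimes> d \<in> H"
            have "inv e \<otimes> d \<in> K" if "K \<in> S" for K
            proof -
              interpret K: subgroup K G using sub S(1) that by blast
              show ?thesis using K.m_closed[OF K.m_inv_closed, of e d] that e(1) d(2) by blast
            qed
            \<comment> \<open>Membership in \<open>H\<close> comes from writing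
              \<open>inv e \<otimes> d\<close> as a quotient of \<open>g \<otimes> e\<close> and
              \<open>g \<otimes> d\<close>, both in \<open>H\<close>; the factor \<open>g\<close>
              cancels.\<close>
            moreover have "inv (g \<otimes> e) \<otimes> (g \<otimes> d) = inv e \<otimes> (inv g \<otimes> (g \<otimes> d))"
              using e(1) d(1) g(1) by (simp add: inv_mult_group m_assoc)
            then have "inv (g \<otimes> e) \<otimes> (g \<otimes> d) = inv e \<otimes> d"
              using d(1) g(1) by (simp flip: m_assoc)
            then have "inv e \<otimes> d \<in> H" using H.m_closed[OF H.m_inv_closed[OF e(2)] d(3)] by simp
            ultimately show "inv e \<otimes> d \<in> ?D (insert H S)"
              using e(1) d(1) by simp
          qed
        qed (use fin in simp)
      qed
    qed
    finally have le: "card (?D S) \<le> (\<Sum>H\<in>F - S. card (?D (insert H S)))" .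
    have "\<exists>H\<in>F - S. card (?D S) \<le> card F * card (?D (insert H S))"
    proof (rule ccontr)
      let ?c = "card (?D S)"
      assume "\<not> ?thesis"
      then have less: "\<And>H. H \<in> F - S \<Longrightarrow> card F * card (?D (insert H S)) < ?c"
        by (auto simp: not_le)
      have "card F * ?c \<le> (\<Sum>H\<in>F - S. card F * card (?D (insert H S)))"
        using mult_le_mono2[OF le, of "card F"] by (simp only: sum_distrib_left)
      \<comment> \<open>Strictness requires a nonempty index set, and \<open>H0\<close> is a member
        of \<open>F - S\<close>.\<close>
      also have "\<dots> < (\<Sum>H\<in>F - S. ?c)"
        using less finF \<open>H0 \<in> F\<close> \<open>H0 \<notin> S\<close> by (intro sum_strict_mono) auto
      also have "\<dots> \<le> card F * ?c"
        using finF by (simp add: card_mono)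
      finally show False by simp
    qed
    then obtain H where H: "H \<in> F - S" "card (?D S) \<le> card F * card (?D (insert H S))"
      by blast
    have "order G \<le> card F ^ k * (card F * card (?D (insert H S)))"
      using S(3) mult_le_mono2[OF H(2)] le_trans by blast
    then show ?case
      using H(1) S finS by (intro exI[of _ "insert H S"]) (simp add: mult_ac)
  qed
  then obtain S where S: "S \<subseteq> F" "card S = card F" "order G \<le> card F ^ card F * card (?D S)"
    by blast
  have "S = F" using S finF card_subset_eq by blast
  moreover have "F \<noteq> {}" using cover one_closed by blast
  then have "?D F = \<Inter>F" using sub subgroup.subset by blast
  ultimately show ?thesis using S(3) by simp
qed

section \<open>The center and the intersection of the maximal cyclic subgroups\<close>

lemma group_center_iff:
  "z \<in> group_center G \<longleftrightarrow> z \<in> carrier G \<and> (\<forall>x\<in>carrier G. z \<otimes>\<^bsub>G\<^esub> x = x \<otimes>\<^bsub>G\<^esub> z)"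
  unfolding group_center_def by blast

lemma group_center_comm:
  "z \<in> group_center G \<Longrightarrow> x \<in> carrier G \<Longrightarrow> z \<otimes>\<^bsub>G\<^esub> x = x \<otimes>\<^bsub>G\<^esub> z"
  unfolding group_center_iff by blast

lemma group_center_subset: "group_center G \<subseteq> carrier G"
  unfolding group_center_def by blast

lemma (in group) group_center_subgroup: "subgroup (group_center G) G"
proof
  fix x y assume xy: "x \<in> group_center G" "y \<in> group_center G"
  then have c: "x \<in> carrier G" "y \<in> carrier G" by (auto intro: subsetD[OF group_center_subset])
  have "(x \<otimes> y) \<otimes> w = w \<otimes> (x \<otimes> y)" if w: "w \<in> carrier G" for w
  proof -
    have "(x \<otimes> y) \<otimes> w = x \<otimes> (y \<otimes> w)"
      using c w by (simp add: m_assoc)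
    also have "\<dots> = (x \<otimes> w) \<otimes> y"
      using c w unfolding group_center_comm[OF xy(2) w] by (simp add: m_assoc)
    also have "\<dots> = (w \<otimes> x) \<otimes> y"
      unfolding group_center_comm[OF xy(1) w] ..
    finally show ?thesis using c w by (simp add: m_assoc)
  qed
  then show "x \<otimes> y \<in> group_center G"
    using c unfolding group_center_iff by blast
next
  fix x assume x: "x \<in> group_center G"
  then have xc: "x \<in> carrier G" by (rule subsetD[OF group_center_subset])
  have "inv x \<otimes> y = y \<otimes> inv x" if y: "y \<in> carrier G" for y
  proof -
    have "inv (x \<otimes> inv y) = inv (inv y \<otimes> x)"
      using group_center_comm[OF x inv_closed[OF y]] by (rule arg_cong)
    then show ?thesis using xc y by (simp add: inv_mult_group)
  qed
  then show "inv x \<in> group_center G" using xc unfolding group_center_iff by blast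
next
  show "\<one> \<in> group_center G" by (simp add: group_center_iff)
qed (rule group_center_subset)

text \<open>Any \<open>x\<close> lies in some maximal cyclic subgroup, which is abelian and also
  contains \<open>z\<close>.\<close>

lemma (in group) Inter_maximal_cyclic_le_center:
  assumes fin: "finite (carrier G)"
  shows "\<Inter>{H. is_maximal_cyclic_subgroup H G} \<subseteq> group_center G"
proof
  fix z assume z: "z \<in> \<Inter>{H. is_maximal_cyclic_subgroup H G}"
  have comm: "z \<in> carrier G \<and> z \<otimes> x = x \<otimes> z" if x: "x \<in> carrier G" for x
  proof -
    obtain M where M: "is_maximal_cyclic_subgroup M G" "x \<in> M"
      using ex_maximal_cyclic_subgroup fin x by blast
    have sub: "subgroup M G" and cyc: "cyclic_group (G\<lparr>carrier := M\<rparr>)"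
      using M(1) by (auto simp: is_maximal_cyclic_subgroup_def)
    interpret M: comm_group "G\<lparr>carrier := M\<rparr>"
      using cyc sub by (intro group.cyclic_imp_abelian_group subgroup_imp_group)
    have "z \<in> M" using z M(1) by blast
    then show ?thesis using M.m_comm[of z x] M(2) subgroup.mem_carrier[OF sub] by simp
  qed
  \<comment> \<open>\<open>comm\<close> yields \<open>z \<in> carrier G\<close> only once some
    \<open>x\<close> is given; \<open>\<one>\<close> serves as that \<open>x\<close>.\<close>
  then show "z \<in> group_center G" using one_closed unfolding group_center_iff by blast
qed

text \<open>This is where the condition on the Sylow subgroups of the center enters: a nontrivial
  intersection would make one of them nontrivial and cyclic.\<close>

lemma (in group) Inter_maximal_cyclic_trivial:
  assumes fin: "finite (carrier G)"
    and noncyclic: "\<And>p P. is_Sylow_subgroup p P (G\<lparr>carrier := group_center G\<rparr>) \<Longrightarrow>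
      P \<noteq> {\<one>} \<Longrightarrow> \<not> cyclic_group (G\<lparr>carrier := P\<rparr>)"
  shows "\<Inter>{H. is_maximal_cyclic_subgroup H G} = {\<one>}"
proof (rule ccontr)
  let ?D = "\<Inter>{H. is_maximal_cyclic_subgroup H G}"
  let ?Z = "G\<lparr>carrier := group_center G\<rparr>"
  assume nontriv: "?D \<noteq> {\<one>}"
  have D_sub: "subgroup ?D G"
    using ex_maximal_cyclic_subgroup[OF fin one_closed]
    by (intro subgroups_Inter) (auto simp: is_maximal_cyclic_subgroup_def)
  then obtain c where c: "c \<in> ?D" "c \<noteq> \<one>" using nontriv subgroup.one_closed by blast
  have cc: "c \<in> carrier G" using subgroup.mem_carrier[OF D_sub c(1)] .
  then have "ord c \<noteq> 1" using c(2) ord_eq_1 by blast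
  then obtain p where p: "Factorial_Ring.prime p" "p dvd ord c" using prime_factor_nat by blast
  \<comment> \<open>A power of \<open>c\<close> of prime order \<open>p\<close>; it stays in the
    subgroup \<open>?D\<close>.\<close>
  define d where "d = c [^] (ord c div p)"
  have ordc: "ord c > 0" using ord_ge_1[OF fin cc] by simp
  have ordd: "ord d = p"
  proof -
    obtain q where q: "ord c = p * q" using p(2) by blast
    then have "p > 0" "q > 0" using ordc by auto
    then show ?thesis using ord_pow[OF cc, of q] by (simp add: d_def q)
  qed
  have dc: "d \<in> carrier G" using cc by (simp add: d_def)
  have d: "d \<in> ?D"
    using c(1) D_sub generate_subgroup_incl[of "{c}" ?D] generate_pow_on_finite_carrier[OF fin cc]
    by (auto simp: d_def)
  have dp: "d [^] p = \<one>" using ordd dc by (metis pow_ord_eq_1)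
  interpret Zs: subgroup "group_center G" G by (rule group_center_subgroup)
  interpret Z: group ?Z by (rule subgroup_imp_group[OF group_center_subgroup])
  have finZ: "finite (carrier ?Z)" using fin finite_subset[OF group_center_subset] by simp
  have dZ: "d \<in> group_center G" using d Inter_maximal_cyclic_le_center[OF fin] by blast
  have "p dvd order ?Z"
  proof -
    have "Z.ord d = p"
      using dZ pow_eq_id[OF dc] Z.ord_unique[of d p] by (simp add: ordd flip: nat_pow_consistent)
    then show ?thesis using Z.ord_dvd_group_order[of d] dZ by simp
  qed
  define m where "m = multiplicity p (order ?Z)"
  have order0: "order ?Z > 0" using finZ Z.order_gt_0_iff_finite by blast
  \<comment> \<open>This makes the Sylow subgroup \<open>P\<close> below nontrivial, so that
    \<open>noncyclic\<close> applies to it.\<close>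
  have m: "m > 0"
    using \<open>p dvd order ?Z\<close> p(1) order0 prime_multiplicity_gt_zero_iff[of p "order ?Z"] by (simp add: m_def)
  have "p ^ m dvd order ?Z" by (simp add: m_def multiplicity_dvd)
  then obtain l where "order ?Z = p ^ m * l" by blast
  then obtain P where P: "subgroup P ?Z" "card P = p ^ m"
    using sylow_thm[OF p(1) Z.is_group _ finZ] by blast
  have Syl: "is_Sylow_subgroup p P ?Z"
    using P p(1) by (simp add: is_Sylow_subgroup_def m_def)
  have PZ: "P \<subseteq> group_center G" using P(1) subgroup.subset by fastforce
  have PG: "subgroup P G" using P(1) group_center_subgroup incl_subgroup by blast
  have "P \<noteq> {\<one>}" using P(2) m one_less_power[OF prime_gt_1_nat[OF p(1)] m] by auto
  interpret P: comm_group "G\<lparr>carrier := P\<rparr>"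
  proof (rule group.group_comm_groupI[OF subgroup_imp_group[OF PG]])
    fix x y assume "x \<in> carrier (G\<lparr>carrier := P\<rparr>)" "y \<in> carrier (G\<lparr>carrier := P\<rparr>)"
    then have "x \<in> group_center G" "y \<in> carrier G" using PZ Zs.mem_carrier by auto
    then show "x \<otimes>\<^bsub>G\<lparr>carrier := P\<rparr>\<^esub> y = y \<otimes>\<^bsub>G\<lparr>carrier := P\<rparr>\<^esub> x"
      using group_center_comm by simp
  qed
  \<comment> \<open>Whichever maximal cyclic subgroup contains \<open>y\<close>, it contains
    \<open>d\<close> too, and its elements killed by \<open>p\<close> lie in
    \<open>generate G {d}\<close>.\<close>
  have "{x \<in> P. x [^] p = \<one>} \<subseteq> generate G {d}"
  proof clarify
    fix y assume y: "y \<in> P" "y [^] p = \<one>"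
    have "y \<in> carrier G" using subgroup.mem_carrier[OF PG y(1)] .
    then obtain M where M: "is_maximal_cyclic_subgroup M G" "y \<in> M"
      using ex_maximal_cyclic_subgroup fin by blast
    moreover obtain a where "a \<in> carrier G" "M = generate G {a}"
      using M(1) maximal_cyclic_subgroupE by blast
    moreover have "d \<in> M" using d M(1) by blast
    ultimately show "y \<in> generate G {d}"
      using prime_order_mem_generate fin p(1) ordd y(2) by blast
  qed
  then have "card {x \<in> P. x [^] p = \<one>} \<le> card (generate G {d})"
    using fin dc generate_incl[of "{d}"] by (intro card_mono) (auto intro: finite_subset)
  also have "\<dots> = p" using generate_pow_card[OF dc] ordd by simp
  finally have "card {x \<in> P. x [^] p = \<one>} \<le> p" .
  then have "cyclic_group (G\<lparr>carrier := P\<rparr>)"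
    using P.cyclic_group_of_prime_torsion_le[of p m] p(1) P(2)
    by (simp add: order_def flip: nat_pow_consistent)
  then show False using noncyclic[OF Syl] \<open>P \<noteq> {\<one>}\<close> by blast
qed

text \<open>A generator of one maximal cyclic subgroup lies in no other, since the other would
  properly contain the first. So these subgroups form an irredundant cover.\<close>

lemma (in group) order_le_maximal_cyclic:
  assumes fin: "finite (carrier G)"
  defines "k \<equiv> num_maximal_cyclic_subgroups G"
  shows "order G \<le> k ^ k * card (\<Inter>{H. is_maximal_cyclic_subgroup H G})"
  unfolding k_def num_maximal_cyclic_subgroups_def
proof (rule order_le_irredundant_cover)
  show "finite {H. is_maximal_cyclic_subgroup H G}"
    using fin by (auto intro: finite_subset[of _ "Pow (carrier G)"] dest: subgroup.subset
        simp: is_maximal_cyclic_subgroup_def)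
  show "carrier G \<subseteq> \<Union>{H. is_maximal_cyclic_subgroup H G}"
    using ex_maximal_cyclic_subgroup[OF fin] by blast
next
  fix H assume "H \<in> {H. is_maximal_cyclic_subgroup H G}"
  then have H: "is_maximal_cyclic_subgroup H G" by simp
  then obtain x where x: "x \<in> carrier G" "H = generate G {x}"
    by (rule maximal_cyclic_subgroupE)
  have "x \<notin> \<Union>({H. is_maximal_cyclic_subgroup H G} - {H})"
  proof
    assume "x \<in> \<Union>({H. is_maximal_cyclic_subgroup H G} - {H})"
    then obtain K where K: "is_maximal_cyclic_subgroup K G" "K \<noteq> H" "x \<in> K" by blast
    then have "H \<subset> K"
      using x generate_subgroup_incl[of "{x}" K] by (auto simp: is_maximal_cyclic_subgroup_def)
    then show False
      using H K(1) by (auto simp: is_maximal_cyclic_subgroup_def)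
  qed
  then show "\<not> carrier G \<subseteq> \<Union>({H. is_maximal_cyclic_subgroup H G} - {H})"
    using x(1) by blast
qed (use fin in \<open>auto simp: is_maximal_cyclic_subgroup_def\<close>)

section \<open>Finitely many groups of bounded order up to isomorphism\<close>

text \<open>The value of \<open>f\<close> at a member determines its class, so sending a value to
  the class of a chosen preimage hits every class.\<close>

lemma finite_quotient_of_invariant:
  assumes "equiv A r" "finite (f ` A)"
    and "\<And>x y. x \<in> A \<Longrightarrow> y \<in> A \<Longrightarrow> f x = f y \<Longrightarrow> (x, y) \<in> r"
  shows "finite (A // r)"
proof -
  have "A // r \<subseteq> (\<lambda>b. r `` {inv_into A f b}) ` f ` A"
  proof
    fix C assume "C \<in> A // r"
    then obtain x where x: "x \<in> A" "C = r `` {x}" by (rule quotientE)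
    have "(x, inv_into A f (f x)) \<in> r"
      using x(1) assms(3) by (simp add: inv_into_into f_inv_into_f)
    then have "C = r `` {inv_into A f (f x)}"
      using x(2) assms(1) equiv_class_eq by metis
    then show "C \<in> (\<lambda>b. r `` {inv_into A f b}) ` f ` A" using x(1) by blast
  qed
  then show ?thesis using assms(2) finite_subset by blast
qed

text \<open>\<open>h\<close> and \<open>k\<close> label the elements by \<open>N\<close>, and the
  sets of triples are the relabelled multiplication tables; the isomorphism matches elements with
  equal labels.\<close>

lemma is_iso_of_same_table:
  assumes h: "bij_betw h (carrier G) N" and k: "bij_betw k (carrier H) N"
    and "group G" "group H"
    and eq: "{(h x, h y, h (x \<otimes>\<^bsub>G\<^esub> y)) | x y. x \<in> carrier G \<and> y \<in> carrier G} =
      {(k x, k y, k (x \<otimes>\<^bsub>H\<^esub> y)) | x y. x \<in> carrier H \<and> y \<in> carrier H}"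
  shows "G \<cong> H"
proof -
  interpret G: group G by fact
  interpret H: group H by fact
  let ?f = "\<lambda>x. inv_into (carrier H) k (h x)"
  have kf: "?f x \<in> carrier H" "k (?f x) = h x" if "x \<in> carrier G" for x
    using that h k by (auto simp: bij_betw_def inv_into_into f_inv_into_f)
  have "bij_betw ?f (carrier G) (carrier H)"
    using bij_betw_trans[OF h bij_betw_inv_into[OF k]] by (simp add: comp_def)
  moreover have "?f (x \<otimes>\<^bsub>G\<^esub> y) = ?f x \<otimes>\<^bsub>H\<^esub> ?f y" if x: "x \<in> carrier G" and y: "y \<in> carrier G" for x y
  proof -
    obtain u v where uv: "u \<in> carrier H" "v \<in> carrier H" "h x = k u" "h y = k v"
        "h (x \<otimes>\<^bsub>G\<^esub> y) = k (u \<otimes>\<^bsub>H\<^esub> v)"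
      \<comment> \<open>The triple of \<open>x\<close> and \<open>y\<close> also occurs in the table
        of \<open>H\<close>; injectivity of \<open>k\<close> then identifies \<open>u\<close> and
        \<open>v\<close> with the images under \<open>?f\<close>.\<close>
      using eq x y by (auto simp: set_eq_iff) blast
    then show ?thesis using k by (simp add: bij_betw_def inv_into_f_f)
  qed
  ultimately have "?f \<in> iso G H"
    using kf(1) by (simp add: iso_def hom_def)
  then show ?thesis unfolding is_iso_def by blast
qed

lemma finite_up_to_iso_bounded_order:
  assumes grp: "\<And>G. G \<in> A \<Longrightarrow> group G \<and> finite (carrier G) \<and> order G \<le> N"
  shows "finite_up_to_iso A"
proof -
  have "\<exists>h. bij_betw h (carrier G) {..<order G}" if "G \<in> A" for G
    using that grp ex_bij_betw_finite_nat by (fastforce simp: order_def atLeast0LessThan)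
  then obtain h where h: "\<And>G. G \<in> A \<Longrightarrow> bij_betw (h G) (carrier G) {..<order G}"
    by metis
  \<comment> \<open>The invariant is the multiplication table on \<open>{..<order G}\<close>. The
    order is recorded too, so that equal values of \<open>T\<close> mean a common label set.\<close>
  define T where "T G = (order G, {(h G x, h G y, h G (x \<otimes>\<^bsub>G\<^esub> y)) | x y.
    x \<in> carrier G \<and> y \<in> carrier G})" for G
  show ?thesis
    unfolding finite_up_to_iso_def
  proof (rule finite_quotient_of_invariant)
    show "equiv A {(G, H). G \<in> A \<and> H \<in> A \<and> G \<cong> H}"
      using grp by (intro equivI refl_onI symI transI) (auto intro: group.iso_sym iso_trans)
    have "T G \<in> {..N} \<times> Pow ({..<N} \<times> {..<N} \<times> {..<N})" if "G \<in> A" for G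
    proof -
      interpret group G using grp that by blast
      have "h G x < N" if "x \<in> carrier G" for x
        using h[OF \<open>G \<in> A\<close>] grp[OF \<open>G \<in> A\<close>] that bij_betwE by fastforce
      then show ?thesis using grp[OF that] by (auto simp: T_def)
    qed
    then have "T ` A \<subseteq> {..N} \<times> Pow ({..<N} \<times> {..<N} \<times> {..<N})" by blast
    then show "finite (T ` A)" by (rule finite_subset) simp
  next
    fix G H assume GH: "G \<in> A" "H \<in> A" "T G = T H"
    then have "G \<cong> H"
      using is_iso_of_same_table[of "h G" G "{..<order G}" "h H" H] h[of G] h[of H] grp
      by (simp add: T_def)
    then show "(G, H) \<in> {(G, H). G \<in> A \<and> H \<in> A \<and> G \<cong> H}" using GH by simp
  qed
qed

section \<open>From the number of maximal cyclic subgroups to a bound on the order\<close>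

theorem theorem1p3:
  shows "maximal_cyclic_bounded
    {G :: 'a monoid. group G \<and> finite (carrier G) \<and>
       (\<forall>p P. is_Sylow_subgroup p P (G\<lparr>carrier := group_center G\<rparr>) \<and> P \<noteq> {\<one>\<^bsub>G\<^esub>} \<longrightarrow>
          \<not> cyclic_group (G\<lparr>carrier := P\<rparr>))}"
  (is "maximal_cyclic_bounded ?F")
proof -
  \<comment> \<open>The base \<open>Suc n\<close> is at least 1 even for \<open>n = 0\<close>, as
    monotonicity in the exponent requires.\<close>
  have "order G \<le> Suc n ^ Suc n"
    if G: "G \<in> ?F" and n: "num_maximal_cyclic_subgroups G \<le> n" for G n
  proof -
    let ?k = "num_maximal_cyclic_subgroups G"
    interpret group G using G by blast
    \<comment> \<open>The intersection is trivial, so its cardinality contributes a factor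
      1.\<close>
    have "order G \<le> ?k ^ ?k"
      using order_le_maximal_cyclic Inter_maximal_cyclic_trivial G by fastforce
    also have "\<dots> \<le> Suc n ^ ?k" using n by (intro power_mono) auto
    also have "\<dots> \<le> Suc n ^ Suc n" using n by (intro power_increasing) auto
    finally show ?thesis .
  qed
  then have "finite_up_to_iso {G \<in> ?F. num_maximal_cyclic_subgroups G \<le> n}" for n
    by (intro finite_up_to_iso_bounded_order[of _ "Suc n ^ Suc n"]) blast
  then show ?thesis unfolding maximal_cyclic_bounded_def by blast
qed

end
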